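(* Let $(G,p)$ be a finite bar-joint framework in $(\mathbb R^d,\|\cdot\|_q)$ where $q\in(1,2)\cup(2,\infty)$, and let $$\mathcal V(G)=\left\{x\in\mathbb R^{d|V(G)|}:\prod_{vw\in E(G)}\prod_{i=1}^d(x_{v,i}-x_{w,i})=0\right\}.$$ If $p\notin\mathcal V(G)$ then the following statements are equivalent. (i) $(G,p)$ is continuously rigid and regular. (ii) $(G,p)$ is infinitesimally rigid.
   Context: Here $d\ge2$, $\|\cdot\|_q$ is the $\ell^q$ norm on $\mathbb R^d$, and a placement $p$ is identified with a point $(p_v)_{v\in V(G)}$ of $\mathbb R^{d|V(G)|}$, with $p_v=(p_{v,1},\dots,p_{v,d})$. A bar-joint framework $(G,p)$ in a normed space $X$ consists of a simple graph $G$ and a map (placement) $p:V(G)\to X$ with $p_v\neq p_w$ whenever $vw\in E(G)$; $P(G)$ is the set of placements in $X$. A continuous rigid motion of $X$ is a map $\Gamma:X\times[-1,1]\to X$, isometric in $x$, continuous in $t$, with $\Gamma(x,0)=x$ for all $x$. A continuous flex of $(G,p)$ is a family of continuous paths $\alpha_v:[-1,1]\to X$, $v\in V(G)$, with $\alpha_v(0)=p_v$ for all $v$ and $\|\alpha_v(t)-\alpha_w(t)\|=\|p_v-p_w\|$ for all $t\in[-1,1]$ and all $vw\in E(G)$. It is trivial if there is a continuous rigid motion $\Gamma$ with $\alpha_v(t)=\Gamma(p_v,t)$ for all $v$ and $t$. $(G,p)$ is continuously rigid if every continuous flex is trivial. An infinitesimal flex is a map $u:V(G)\to X$ with $\|(p_v+tu_v)-(p_w+tu_w)\|-\|p_v-p_w\|=o(t)$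 as $t\to0$ for each edge $vw$. It is trivial if $u_v=\gamma(p_v)$ for all $v$, where $\gamma(x)=\frac d{dt}\Gamma(x,t)|_{t=0}$ is derived from some continuous rigid motion $\Gamma$. $(G,p)$ is infinitesimally rigid if every infinitesimal flex is trivial. The rigidity matrix $R_q(G,p)$ is the $|E(G)|\times d|V(G)|$ matrix whose row for the edge $vw$ has $(p_v-p_w)^{(q-1)}$ in the $d$ columns of $v$, $-(p_v-p_w)^{(q-1)}$ in the $d$ columns of $w$ and zeros elsewhere, where $x^{(s)}=(\mathrm{sgn}(x_1)|x_1|^s,\dots,\mathrm{sgn}(x_d)|x_d|^s)$. $(G,p)$ is regular if $x\mapsto\operatorname{rank}R_q(G,x)$, $x\in P(G)$, attains its maximum at $p$. *)

theory Defs
  imports "HOL-Analysis.Analysis" "HOL-Library.Landau_Symbols"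
begin

text \<open>
  The vertex set of a finite graph is the universe of a finite type \<open>'v\<close>, and its edges are
  two-element sets of vertices.  A placement in \<open>\<real>\<^sup>d\<close>, with \<open>d = CARD('d)\<close>, is a vector of type
  \<open>real ^ 'd ^ 'v\<close>, that is, a point of the space of dimension \<open>d |V(G)|\<close>.
\<close>

definition simple_graph :: "'v set set \<Rightarrow> bool" where
  "simple_graph E \<longleftrightarrow> (\<forall>e\<in>E. card e = 2)"

text \<open>
  An arbitrary but fixed ordering \<open>(v, w)\<close> of the two ends of each edge.  Exchanging \<open>v\<close> and \<open>w\<close>
  leaves the rows of the rigidity matrix below unchanged, and multiplies the defining polynomial of
  \<open>coincidence_variety\<close> by a sign.
\<close>

definition ends :: "'v set \<Rightarrow> 'v \<times> 'v" where
  "ends e = (SOME (v, w). e = {v, w})"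

definition lq_norm :: "real \<Rightarrow> real ^ 'd \<Rightarrow> real" where
  "lq_norm q x = (\<Sum>i\<in>UNIV. \<bar>x $ i\<bar> powr q) powr (1 / q)"

definition placements :: "'v set set \<Rightarrow> (real ^ 'd ^ 'v) set" where
  "placements E = {p. \<forall>v w. {v, w} \<in> E \<longrightarrow> p $ v \<noteq> p $ w}"

definition framework :: "'v set set \<Rightarrow> real ^ 'd ^ 'v \<Rightarrow> bool" where
  "framework E p \<longleftrightarrow> simple_graph E \<and> p \<in> placements E"

text \<open>
  Continuity and differentiability below refer to the standard topology of \<open>real ^ 'd\<close>, which is
  also the topology of the \<open>q\<close>-norm.  Only the values of paths and motions on the time interval
  \<open>{-1..1}\<close> are relevant.
\<close>

definition rigid_motion :: "real \<Rightarrow> (real ^ 'd \<Rightarrow> real \<Rightarrow> real ^ 'd) \<Rightarrow> bool" where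
  "rigid_motion q \<Gamma> \<longleftrightarrow>
     (\<forall>t\<in>{-1..1}. \<forall>x y. lq_norm q (\<Gamma> x t - \<Gamma> y t) = lq_norm q (x - y)) \<and>
     (\<forall>x. continuous_on {-1..1} (\<Gamma> x)) \<and>
     (\<forall>x. \<Gamma> x 0 = x)"

definition continuous_flex ::
    "real \<Rightarrow> 'v set set \<Rightarrow> real ^ 'd ^ 'v \<Rightarrow> ('v \<Rightarrow> real \<Rightarrow> real ^ 'd) \<Rightarrow> bool" where
  "continuous_flex q E p \<alpha> \<longleftrightarrow>
     (\<forall>v. continuous_on {-1..1} (\<alpha> v) \<and> \<alpha> v 0 = p $ v) \<and>
     (\<forall>t\<in>{-1..1}. \<forall>v w. {v, w} \<in> E \<longrightarrow>
        lq_norm q (\<alpha> v t - \<alpha> w t) = lq_norm q (p $ v - p $ w))"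

definition trivial_continuous_flex ::
    "real \<Rightarrow> real ^ 'd ^ 'v \<Rightarrow> ('v \<Rightarrow> real \<Rightarrow> real ^ 'd) \<Rightarrow> bool" where
  "trivial_continuous_flex q p \<alpha> \<longleftrightarrow>
     (\<exists>\<Gamma>. rigid_motion q \<Gamma> \<and> (\<forall>v. \<forall>t\<in>{-1..1}. \<alpha> v t = \<Gamma> (p $ v) t))"

definition continuously_rigid :: "real \<Rightarrow> 'v set set \<Rightarrow> real ^ 'd ^ 'v \<Rightarrow> bool" where
  "continuously_rigid q E p \<longleftrightarrow>
     (\<forall>\<alpha>. continuous_flex q E p \<alpha> \<longrightarrow> trivial_continuous_flex q p \<alpha>)"

definition infinitesimal_flex ::
    "real \<Rightarrow> 'v set set \<Rightarrow> real ^ 'd ^ 'v \<Rightarrow> real ^ 'd ^ 'v \<Rightarrow> bool" where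
  "infinitesimal_flex q E p u \<longleftrightarrow>
     (\<forall>v w. {v, w} \<in> E \<longrightarrow>
        (\<lambda>t. lq_norm q ((p $ v + t *\<^sub>R u $ v) - (p $ w + t *\<^sub>R u $ w)) - lq_norm q (p $ v - p $ w))
          \<in> o[at 0](\<lambda>t. t))"

definition infinitesimal_rigid_motion :: "real \<Rightarrow> (real ^ 'd \<Rightarrow> real ^ 'd) \<Rightarrow> bool" where
  "infinitesimal_rigid_motion q \<gamma> \<longleftrightarrow>
     (\<exists>\<Gamma>. rigid_motion q \<Gamma> \<and>
        (\<forall>x. (\<Gamma> x has_vector_derivative \<gamma> x) (at 0 within {-1..1})))"

definition trivial_infinitesimal_flex ::
    "real \<Rightarrow> real ^ 'd ^ 'v \<Rightarrow> real ^ 'd ^ 'v \<Rightarrow> bool" where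
  "trivial_infinitesimal_flex q p u \<longleftrightarrow>
     (\<exists>\<gamma>. infinitesimal_rigid_motion q \<gamma> \<and> (\<forall>v. u $ v = \<gamma> (p $ v)))"

definition infinitesimally_rigid :: "real \<Rightarrow> 'v set set \<Rightarrow> real ^ 'd ^ 'v \<Rightarrow> bool" where
  "infinitesimally_rigid q E p \<longleftrightarrow>
     (\<forall>u. infinitesimal_flex q E p u \<longrightarrow> trivial_infinitesimal_flex q p u)"

definition signed_power :: "real \<Rightarrow> real ^ 'd \<Rightarrow> real ^ 'd" where
  "signed_power s x = (\<chi> i. sgn (x $ i) * \<bar>x $ i\<bar> powr s)"

text \<open>
  Columns are indexed by pairs of a vertex and a coordinate.  Rows are indexed by all sets of
  vertices, because the edge set is not a type; the rows of non-edges are zero, which does not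
  affect the rank.
\<close>

definition rigidity_matrix ::
    "real \<Rightarrow> 'v::finite set set \<Rightarrow> real ^ 'd ^ 'v \<Rightarrow> real ^ ('v \<times> 'd) ^ 'v set" where
  "rigidity_matrix q E p = (\<chi> e c.
     case (ends e, c) of ((v, w), (u, i)) \<Rightarrow>
       if e \<notin> E then 0
       else if u = v then signed_power (q - 1) (p $ v - p $ w) $ i
       else if u = w then - signed_power (q - 1) (p $ v - p $ w) $ i
       else 0)"

definition regular :: "real \<Rightarrow> 'v::finite set set \<Rightarrow> real ^ 'd ^ 'v \<Rightarrow> bool" where
  "regular q E p \<longleftrightarrow>
     (\<forall>x\<in>(placements E :: (real ^ 'd ^ 'v) set). rank (rigidity_matrix q E x) \<le> rank (rigidity_matrix q E p))"

definition coincidence_variety :: "'v::finite set set \<Rightarrow> (real ^ 'd ^ 'v) set" where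
  "coincidence_variety E =
     {x. (\<Prod>e\<in>E. case ends e of (v, w) \<Rightarrow> \<Prod>i\<in>UNIV. x $ v $ i - x $ w $ i) = 0}"

end

theory Submission
  imports Defs
begin

text \<open>
  Since \<open>q > 1\<close>, the function \<open>\<bar>s\<bar>\<^sup>q\<close> is continuously differentiable on the whole line.  Hence the
  map which sends a placement \<open>x\<close> to the numbers \<open>\<parallel>x\<^sub>v - x\<^sub>w\<parallel>\<^sup>q / q\<close>, one for each edge, is
  continuously differentiable everywhere, and its derivative \<open>R(x)\<close> is given by the rigidity
  matrix.  Infinitesimal flexes of \<open>(G, p)\<close> are the elements of the kernel of \<open>R(p)\<close>.

  The exponent \<open>q \<noteq> 2\<close> enters through \<open>rigid_motion_translation\<close>: all rigid motions are
  translations.  The complete graph on a grid with three levels in each coordinate is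
  infinitesimally rigid, because \<open>sgn s \<bar>s\<bar>\<^sup>q\<^sup>-\<^sup>1\<close> is not additive; so every rigid motion translates
  every grid.  Consequently a flex of either kind is trivial precisely if it moves all vertices
  alike, and infinitesimal rigidity says that the kernel of \<open>R(p)\<close> consists of the translations
  (\<open>infinitesimally_rigid_iff_kernel\<close>).

  If it does, then \<open>R(p)\<close> has the largest possible rank, because translations lie in every kernel,
  and \<open>p\<close> is isolated, up to translations, among the placements with the same edge lengths; a
  continuous flex can therefore only translate \<open>p\<close> (\<open>continuous_flex_congruent\<close>).

  Conversely, if \<open>p\<close> is regular, the rank of \<open>R\<close> is locally largest at \<open>p\<close>, and then every \<open>u\<close>
  in the kernel of \<open>R(p)\<close> is the initial velocity of a curve of placements with the same edge
  lengths (\<open>curve_in_level_set_of_maximal_rank\<close>).  This curve is a continuous flex.  If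
  \<open>(G, p)\<close> is continuously rigid, the flex consists of translations of \<open>p\<close>, so its velocity
  \<open>u\<close> is a translation too.
\<close>

section \<open>A curve in a level set of maximal rank\<close>

text \<open>
  Rank and nullity: on the orthogonal complement of its kernel, \<open>f\<close> is injective and has the same
  range.
\<close>

lemma dim_kernel_plus_dim_range:
  fixes f :: "'a::euclidean_space \<Rightarrow> 'b::euclidean_space"
  assumes "linear f"
  shows "dim {x. f x = 0} + dim (range f) = DIM('a)"
proof -
  let ?K = "{x. f x = 0}"
  define W where "W = {y. \<forall>x\<in>?K. orthogonal x y}"
  interpret linear f by fact
  have K: "subspace ?K"
    by (rule linear_subspace_kernel[OF assms])
  have W: "subspace W"
    unfolding W_def by (rule subspace_orthogonal_to_vectors)
  have "inj_on f (span W)"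
    unfolding span_eq_iff[THEN iffD2, OF W]
  proof (rule inj_onI)
    fix x y assume "x \<in> W" "y \<in> W" "f x = f y"
    then have "x - y \<in> W" "x - y \<in> ?K"
      using subspace_diff[OF W] by (auto simp: diff)
    then show "x = y"
      unfolding W_def by (auto simp: orthogonal_def)
  qed
  then have "dim (f ` W) = dim W"
    by (rule dim_image_eq[OF assms])
  moreover have "f ` W = range f"
  proof (intro equalityI subsetI)
    fix z assume "z \<in> range f"
    then obtain x where z: "z = f x" by blast
    obtain y w where "y \<in> span ?K" and w: "\<And>v. v \<in> span ?K \<Longrightarrow> orthogonal w v" and x: "x = y + w"
      by (rule orthogonal_subspace_decomp_exists[of ?K x]) blast
    then have "f y = 0"
      unfolding span_eq_iff[THEN iffD2, OF K] by simp
    moreover have "w \<in> W"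
      using w unfolding W_def by (auto simp: orthogonal_commute intro: span_base)
    ultimately show "z \<in> f ` W"
      using x z by (auto simp: add)
  qed auto
  moreover have "dim W + dim ?K = DIM('a)"
    using dim_subspace_orthogonal_to_vectors[OF K subspace_UNIV] unfolding W_def by simp
  ultimately show ?thesis by simp
qed

text \<open>
  A form of the constant rank theorem.  Put \<open>A = (f' p)\<^sup>*\<close>, let \<open>P\<close> be a projection onto
  \<open>K = ker (f' p)\<close>, and let \<open>F x = P (x - p) + A (f x - f p)\<close>.  As \<open>range A\<close> is orthogonal to
  \<open>K\<close>, the derivative \<open>P + A (f' p)\<close> of \<open>F\<close> at \<open>p\<close> is injective, so \<open>F\<close> has a local inverse
  \<open>g\<close>, and the curve is \<open>\<beta> t = g (t u)\<close>.  Differentiating \<open>F (\<beta> t) = t u\<close> and comparing the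
  parts in \<open>K\<close> and in \<open>range A\<close> gives \<open>A (f' (\<beta> t) (\<beta>' t)) = 0\<close>.  Maximality of the rank at
  \<open>p\<close> is what removes the factor \<open>A\<close>: it keeps the kernel of \<open>f' (\<beta> t)\<close> as large as that of
  \<open>A (f' (\<beta> t))\<close>, so \<open>f\<close> is constant along \<open>\<beta>\<close>.
\<close>

theorem curve_in_level_set_of_maximal_rank:
  fixes f :: "'a::euclidean_space \<Rightarrow> 'b::euclidean_space"
    and f' :: "'a \<Rightarrow> 'a \<Rightarrow>\<^sub>L 'b"
  assumes S: "open S" "p \<in> S"
    and df: "\<And>x. x \<in> S \<Longrightarrow> (f has_derivative f' x) (at x)"
    and cf: "continuous_on S f'"
    and max: "\<And>x. x \<in> S \<Longrightarrow> dim (range (f' x)) \<le> dim (range (f' p))"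
    and u: "f' p u = 0"
  obtains \<beta> \<epsilon> where "\<epsilon> > 0" "\<beta> 0 = p" "continuous_on {-\<epsilon>..\<epsilon>} \<beta>"
    "\<And>t. t \<in> {-\<epsilon>..\<epsilon>} \<Longrightarrow> f (\<beta> t) = f p" "(\<beta> has_vector_derivative u) (at 0)"
proof -
  let ?K = "{h. f' p h = 0}"
  define A where "A = adjoint (f' p)"
  have lin: "linear (blinfun_apply L)" for L :: "'c::real_normed_vector \<Rightarrow>\<^sub>L 'd::real_normed_vector"
    by (rule bounded_linear.linear[OF blinfun.bounded_linear_right])
  have K: "subspace ?K"
    using linear_subspace_kernel[OF lin] .
  have linA: "linear A"
    unfolding A_def by (rule adjoint_linear[OF lin])
  \<comment> \<open>\<open>range A\<close> and \<open>K\<close> are orthogonal, hence meet only in \<open>0\<close>.\<close>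
  have ortho: "A y = 0" if "A y \<in> ?K" for y
  proof -
    have "A y \<bullet> A y = f' p (A y) \<bullet> y"
      unfolding A_def by (rule adjoint_works[OF lin])
    with that show ?thesis by simp
  qed
  have ker: "h \<in> ?K" if "A (f' p h) = 0" for h
  proof -
    have "f' p h \<bullet> f' p h = h \<bullet> A (f' p h)"
      unfolding A_def by (rule adjoint_works[OF lin, symmetric])
    with that show ?thesis by simp
  qed
  obtain P where P: "range P \<subseteq> ?K" "linear P" "\<And>h. h \<in> ?K \<Longrightarrow> P h = h"
    using linear_exists_left_inverse_on[OF linear_id K] by (auto simp: id_def)
  obtain Pb where Pb: "blinfun_apply Pb = P"
    using P(2) by (metis bounded_linear_Blinfun_apply linear_conv_bounded_linear)
  obtain Ab where Ab: "blinfun_apply Ab = A"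
    using linA by (metis bounded_linear_Blinfun_apply linear_conv_bounded_linear)
  define F where "F x = P (x - p) + A (f x - f p)" for x
  define F' where "F' x = Pb + (Ab o\<^sub>L f' x)" for x
  have F': "F' x h = P h + A (f' x h)" for x h
    by (simp add: F'_def Pb Ab blinfun.add_left)
  have dF: "(F has_derivative F' x) (at x)" if "x \<in> S" for x
  proof -
    have "(F has_derivative (\<lambda>h. Pb h + Ab (f' x h))) (at x)"
      unfolding F_def Pb[symmetric] Ab[symmetric]
      by (auto intro!: derivative_eq_intros df that)
    moreover have "blinfun_apply (F' x) = (\<lambda>h. Pb h + Ab (f' x h))"
      by (simp add: fun_eq_iff F' Pb Ab)
    ultimately show ?thesis by simp
  qed
  have cF: "continuous_on S F'"
    unfolding F'_def by (intro continuous_intros cf)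
  have "inj (F' p)"
    unfolding linear_injective_0[OF lin]
  proof (intro allI impI)
    fix h assume "F' p h = 0"
    then have *: "P h = A (- f' p h)"
      by (simp add: F' linear_neg[OF linA] eq_neg_iff_add_eq_0)
    then have "A (- f' p h) \<in> ?K"
      using P(1) by (metis rangeI subsetD)
    then have 0: "A (- f' p h) = 0"
      by (rule ortho)
    then have "h \<in> ?K"
      using ker linear_neg[OF linA] by auto
    with 0 * P(3) show "h = 0" by metis
  qed
  then obtain G where G: "linear G" "G \<circ> F' p = id"
    using linear_injective_left_inverse[OF lin] by blast
  obtain Gb where Gb: "blinfun_apply Gb = G"
    using G(1) by (metis bounded_linear_Blinfun_apply linear_conv_bounded_linear)
  have inv: "Gb o\<^sub>L F' p = id_blinfun"
    using G(2) by (intro blinfun_eqI) (simp add: Gb o_def id_def fun_eq_iff)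
  obtain U V g g' where UV: "open U" "U \<subseteq> S" "p \<in> U" "open V" "F p \<in> V" "homeomorphism U V F g"
      and dg: "\<And>y. y \<in> V \<Longrightarrow> (g has_derivative (g' y)) (at y)"
      and g': "\<And>y. y \<in> V \<Longrightarrow> g' y = inv (blinfun_apply (F' (g y)))"
      and bij: "\<And>y. y \<in> V \<Longrightarrow> bij (blinfun_apply (F' (g y)))"
    by (rule inverse_function_theorem[OF S(1) dF cF S(2) inv]) auto
  have Fp: "F p = 0"
    by (simp add: F_def linear_0[OF P(2)] linear_0[OF linA])
  with UV have gp: "g 0 = p"
    by (metis homeomorphism_apply1)
  have gV: "g y \<in> U" if "y \<in> V" for y
    using UV(6) that by (auto simp: homeomorphism_def)
  \<comment> \<open>\<open>P\<close> embeds the kernel of \<open>A (f' x)\<close> into \<open>K\<close>, and \<open>dim K\<close> is at most the dimension of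
    the kernel of \<open>f' x\<close>; so the inclusion between the two kernels is an equality.\<close>
  have kernel_const: "f' x h = 0" if x: "x = g y" and y: "y \<in> V" and h: "A (f' x h) = 0" for x y h
  proof -
    let ?N = "{h. A (f' x h) = 0}"
    have lN: "linear (\<lambda>h. A (f' x h))"
      using linear_compose[OF lin linA] by (simp add: o_def)
    have inj: "inj (F' x)"
      unfolding x using bij[OF y] by (rule bij_is_inj)
    have "inj_on P (span ?N)"
      unfolding span_eq_iff[THEN iffD2, OF linear_subspace_kernel[OF lN]]
    proof (rule inj_onI)
      fix a b assume "a \<in> ?N" "b \<in> ?N" "P a = P b"
      then have "F' x a = F' x b"
        by (simp add: F')
      with inj show "a = b"
        by (rule injD)
    qed
    then have "dim ?N = dim (P ` ?N)"
      using dim_image_eq[OF P(2)] by metis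
    also have "\<dots> \<le> dim ?K"
      using P(1) by (intro dim_subset) auto
    also have "\<dots> \<le> dim {h. f' x h = 0}"
      using dim_kernel_plus_dim_range[OF lin, of "f' x"] dim_kernel_plus_dim_range[OF lin, of "f' p"]
        max[of x] gV[OF y] UV(2) x by auto
    finally have "dim ?N \<le> dim {h. f' x h = 0}" .
    moreover have "{h. f' x h = 0} \<subseteq> ?N"
      by (auto simp: linear_0[OF linA])
    ultimately have "{h. f' x h = 0} = ?N"
      using subspace_dim_equal[OF linear_subspace_kernel[OF lin] linear_subspace_kernel[OF lN]] by blast
    with h show ?thesis by blast
  qed
  define \<beta> where "\<beta> t = g (t *\<^sub>R u)" for t
  have "open ((\<lambda>t. t *\<^sub>R u) -` V)"
    by (intro open_vimage UV(4) continuous_intros)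
  moreover have "0 \<in> (\<lambda>t::real. t *\<^sub>R u) -` V"
    using UV(5) Fp by simp
  ultimately obtain \<epsilon> where \<epsilon>: "\<epsilon> > 0" and "cball 0 \<epsilon> \<subseteq> (\<lambda>t. t *\<^sub>R u) -` V"
    using open_contains_cball by metis
  then have tV: "t *\<^sub>R u \<in> V" if "t \<in> {-\<epsilon>..\<epsilon>}" for t
    using that by (force simp: cball_def dist_real_def)
  have d\<beta>: "(\<beta> has_vector_derivative g' (t *\<^sub>R u) u) (at t)" if "t \<in> {-\<epsilon>..\<epsilon>}" for t
  proof -
    have "((\<lambda>s. s *\<^sub>R u) has_vector_derivative u) (at t)"
      by (auto intro!: derivative_eq_intros)
    moreover have "(g has_derivative g' (t *\<^sub>R u)) (at (t *\<^sub>R u) within (\<lambda>s. s *\<^sub>R u) ` UNIV)"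
      using dg[OF tV[OF that]] has_derivative_at_withinI by blast
    ultimately show ?thesis
      using vector_derivative_diff_chain_within[of "\<lambda>s. s *\<^sub>R u" u t UNIV g "g' (t *\<^sub>R u)"]
      by (simp add: o_def \<beta>_def[abs_def])
  qed
  have F'g': "F' (\<beta> t) (g' (t *\<^sub>R u) u) = u" if "t \<in> {-\<epsilon>..\<epsilon>}" for t
    using bij[OF tV[OF that]] g'[OF tV[OF that]] by (simp add: \<beta>_def bij_is_surj surj_f_inv_f)
  have tangent: "f' (\<beta> t) (g' (t *\<^sub>R u) u) = 0" if "t \<in> {-\<epsilon>..\<epsilon>}" for t
  proof (rule kernel_const[OF _ tV[OF that]])
    let ?w = "g' (t *\<^sub>R u) u"
    have "A (f' (\<beta> t) ?w) = u - P ?w"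
      using F'g'[OF that] by (simp add: F' algebra_simps)
    also have "\<dots> \<in> ?K"
      using P(1) u subspace_diff[OF K, of u "P ?w"] by auto
    finally show "A (f' (\<beta> t) ?w) = 0"
      by (rule ortho)
  qed (simp add: \<beta>_def)
  have cont: "continuous_on {-\<epsilon>..\<epsilon>} \<beta>"
    using d\<beta> by (meson continuous_at_imp_continuous_on has_vector_derivative_continuous)
  have \<beta>0: "\<beta> 0 = p"
    by (simp add: \<beta>_def gp)
  have "f (\<beta> t) = f p" if t: "t \<in> {-\<epsilon>..\<epsilon>}" for t
  proof -
    have "((\<lambda>t. f (\<beta> t)) has_vector_derivative 0) (at s within {-\<epsilon>..\<epsilon>})" if s: "s \<in> {-\<epsilon>..\<epsilon>}" for s
    proof -
      have "\<beta> s \<in> S"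
        using gV[OF tV[OF s]] UV(2) by (auto simp: \<beta>_def)
      then have "(f has_derivative f' (\<beta> s)) (at (\<beta> s) within \<beta> ` {-\<epsilon>..\<epsilon>})"
        using df has_derivative_at_withinI by blast
      from vector_derivative_diff_chain_within[OF has_vector_derivative_at_within[OF d\<beta>[OF s]] this]
      show ?thesis
        by (simp add: tangent[OF s] o_def)
    qed
    then have "((\<lambda>t. f (\<beta> t)) has_derivative (\<lambda>h. 0)) (at s within {-\<epsilon>..\<epsilon>})" if "s \<in> {-\<epsilon>..\<epsilon>}" for s
      using that by (simp add: has_vector_derivative_def)
    then obtain c where c: "\<And>s. s \<in> {-\<epsilon>..\<epsilon>} \<Longrightarrow> f (\<beta> s) = c"
      using has_derivative_zero_constant[of "{-\<epsilon>..\<epsilon>}" "\<lambda>t. f (\<beta> t)"] by auto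
    then have "f (\<beta> t) = f (\<beta> 0)"
      using t \<epsilon> by simp
    then show ?thesis by (simp add: \<beta>0)
  qed
  moreover have "(\<beta> has_vector_derivative u) (at 0)"
  proof -
    let ?w = "g' 0 u"
    have 0: "0 \<in> {-\<epsilon>..\<epsilon>}" using \<epsilon> by simp
    have "F' p ?w = u" "F' p u = u"
      using F'g'[OF 0] u P(3) by (auto simp: \<beta>0 F' linear_0[OF linA])
    then have "?w = u"
      using \<open>inj (F' p)\<close> by (metis injD)
    with d\<beta>[OF 0] show ?thesis by simp
  qed
  ultimately show ?thesis
    using that \<epsilon> \<beta>0 cont by blast
qed

section \<open>Derivatives of the q-norm\<close>

text \<open>
  At the origin the difference quotient has absolute value \<open>\<bar>h\<bar> powr (q - 1)\<close>, which tends to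
  \<open>0\<close> because \<open>q > 1\<close>.  So there is no exceptional point, and edges with a vanishing coordinate
  difference (as in the grids below) can be treated like all others.
\<close>

lemma has_real_derivative_abs_powr:
  fixes q x :: real
  assumes "1 < q"
  shows "((\<lambda>x. \<bar>x\<bar> powr q) has_real_derivative q * (sgn x * \<bar>x\<bar> powr (q - 1))) (at x)"
proof (cases "x = 0")
  case True
  have "((\<lambda>h. \<bar>h\<bar> powr (q - 1)) \<longlongrightarrow> 0) (at (0::real))"
    using assms by (intro tendsto_zero_powrI[where b = "q - 1"] tendsto_eq_intros) auto
  then have "((\<lambda>h. \<bar>h\<bar> powr q / h) \<longlongrightarrow> 0) (at (0::real))"
  proof (rule Lim_null_comparison[rotated])
    show "\<forall>\<^sub>F h in at 0. norm (\<bar>h\<bar> powr q / h) \<le> \<bar>h\<bar> powr (q - 1)"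
      by (intro always_eventually allI) (simp add: powr_diff)
  qed
  with True show ?thesis
    by (simp add: DERIV_def)
next
  case False
  then consider "x > 0" | "x < 0" by linarith
  then show ?thesis
  proof cases
    case 1
    have "((\<lambda>x. x powr q) has_real_derivative q * (sgn x * \<bar>x\<bar> powr (q - 1))) (at x)"
      using 1 by (auto intro!: derivative_eq_intros)
    then show ?thesis
      by (rule has_field_derivative_transform_within_open[where S = "{0<..}"]) (use 1 in auto)
  next
    case 2
    have "((\<lambda>x. (- x) powr q) has_real_derivative q * (sgn x * \<bar>x\<bar> powr (q - 1))) (at x)"
      using 2 by (auto intro!: derivative_eq_intros)
    then show ?thesis
      by (rule has_field_derivative_transform_within_open[where S = "{..<0}"]) (use 2 in auto)
  qed
qed

lemma continuous_on_sgn_powr: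
  fixes f :: "'a::topological_space \<Rightarrow> real"
  assumes "continuous_on S f" "0 < s"
  shows "continuous_on S (\<lambda>x. sgn (f x) * \<bar>f x\<bar> powr s)"
proof -
  \<comment> \<open>Splitting into positive and negative parts leaves powers of nonnegative functions, for which
    a positive exponent gives continuity even at zeros.\<close>
  have "continuous_on S (\<lambda>x. max (f x) 0 powr s - max (- f x) 0 powr s)"
    using assms by (intro continuous_intros continuous_on_powr') auto
  moreover have "max r 0 powr s - max (- r) 0 powr s = sgn r * \<bar>r\<bar> powr s" for r :: real
    by (cases r "0::real" rule: linorder_cases) (auto simp: max_def)
  ultimately show ?thesis by simp
qed

lemma signed_power_uminus: "signed_power s (- x) = - signed_power s x"
  by (simp add: signed_power_def vec_eq_iff sgn_minus)

lemma lq_norm_uminus: "lq_norm q (- x) = lq_norm q x"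
  by (simp add: lq_norm_def)

lemma lq_norm_powr: "0 < q \<Longrightarrow> lq_norm q x powr q = (\<Sum>i\<in>UNIV. \<bar>x $ i\<bar> powr q)"
  by (simp add: lq_norm_def powr_powr sum_nonneg)

lemma has_real_derivative_sum_powr_line:
  fixes x h :: "real ^ 'd"
  assumes "1 < q"
  shows "((\<lambda>t. \<Sum>i\<in>UNIV. \<bar>(x + t *\<^sub>R h) $ i\<bar> powr q) has_real_derivative
            q * (signed_power (q - 1) x \<bullet> h)) (at 0)"
proof -
  have "((\<lambda>t. \<bar>x $ i + t * h $ i\<bar> powr q) has_real_derivative
           q * (sgn (x $ i) * \<bar>x $ i\<bar> powr (q - 1)) * h $ i) (at 0)" for i
  proof (rule DERIV_chain2[where f = "\<lambda>y. \<bar>y\<bar> powr q"])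
    show "((\<lambda>y. \<bar>y\<bar> powr q) has_real_derivative q * (sgn (x $ i) * \<bar>x $ i\<bar> powr (q - 1)))
            (at (x $ i + 0 * h $ i))"
      using has_real_derivative_abs_powr[OF assms, of "x $ i"] by simp
    show "((\<lambda>t. x $ i + t * h $ i) has_real_derivative h $ i) (at 0)"
      by (auto intro!: derivative_eq_intros)
  qed
  then have "((\<lambda>t. \<Sum>i\<in>UNIV. \<bar>(x + t *\<^sub>R h) $ i\<bar> powr q) has_real_derivative
      (\<Sum>i\<in>UNIV. q * (sgn (x $ i) * \<bar>x $ i\<bar> powr (q - 1)) * h $ i)) (at 0)"
    by (auto intro!: DERIV_sum)
  also have "(\<Sum>i\<in>UNIV. q * (sgn (x $ i) * \<bar>x $ i\<bar> powr (q - 1)) * h $ i) = q * (signed_power (q - 1) x \<bullet> h)"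
    unfolding inner_vec_def signed_power_def sum_distrib_left by (simp add: mult.assoc)
  finally show ?thesis .
qed

text \<open>
  The \<open>q\<close>-norm is a root of the sum of powers, and a root is differentiable with positive
  derivative at a positive argument; this derivative is the factor \<open>c\<close>.
\<close>

lemma has_real_derivative_lq_norm_line:
  fixes x h :: "real ^ 'd"
  assumes "1 < q" "x \<noteq> 0"
  obtains c where "c > 0"
    "((\<lambda>t. lq_norm q (x + t *\<^sub>R h)) has_real_derivative c * (signed_power (q - 1) x \<bullet> h)) (at 0)"
proof -
  let ?s = "\<lambda>t. \<Sum>i\<in>UNIV. \<bar>(x + t *\<^sub>R h) $ i\<bar> powr q"
  obtain i where "x $ i \<noteq> 0"
    using assms(2) vec_eq_iff[of x 0] by auto
  then have "0 < \<bar>x $ i\<bar> powr q" by simp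
  also have "\<dots> \<le> ?s 0"
    using member_le_sum[of i UNIV "\<lambda>i. \<bar>x $ i\<bar> powr q"] by simp
  finally have pos: "0 < ?s 0" .
  have "((\<lambda>t. ?s t powr (1 / q)) has_real_derivative
      1 / q * ?s 0 powr (1 / q - 1) * (q * (signed_power (q - 1) x \<bullet> h))) (at 0)"
    using has_real_derivative_powr[OF pos, of "1 / q"]
    by (rule DERIV_chain2[OF _ has_real_derivative_sum_powr_line[OF assms(1)]])
  moreover have "1 / q * ?s 0 powr (1 / q - 1) * (q * y) = ?s 0 powr (1 / q - 1) * y" for y
    using assms(1) by simp
  ultimately show ?thesis
    using that[of "?s 0 powr (1 / q - 1)"] pos unfolding lq_norm_def by simp
qed

lemma lq_norm_line_stationary_iff:
  fixes x h :: "real ^ 'd"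
  assumes "1 < q" "x \<noteq> 0"
  shows "(\<lambda>t. lq_norm q (x + t *\<^sub>R h) - lq_norm q x) \<in> o[at 0](\<lambda>t. t) \<longleftrightarrow>
           signed_power (q - 1) x \<bullet> h = 0"
proof -
  obtain c where "c > 0" and d: "((\<lambda>t. lq_norm q (x + t *\<^sub>R h)) has_real_derivative
      c * (signed_power (q - 1) x \<bullet> h)) (at 0)"
    using has_real_derivative_lq_norm_line[OF assms] by metis
  have "(\<lambda>t. lq_norm q (x + t *\<^sub>R h) - lq_norm q x) \<in> o[at 0](\<lambda>t. t) \<longleftrightarrow>
      ((\<lambda>t. (lq_norm q (x + t *\<^sub>R h) - lq_norm q x) / t) \<longlongrightarrow> 0) (at 0)"
    by (auto intro!: smalloI_tendsto dest: smalloD_tendsto simp: eventually_at_filter)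
  also have "\<dots> \<longleftrightarrow> ((\<lambda>t. lq_norm q (x + t *\<^sub>R h)) has_real_derivative 0) (at 0)"
    by (simp add: DERIV_def)
  also have "\<dots> \<longleftrightarrow> signed_power (q - 1) x \<bullet> h = 0"
    using d DERIV_unique[OF d, of 0] \<open>c > 0\<close> by auto
  finally show ?thesis .
qed

section \<open>Edge energies and the rigidity map\<close>

text \<open>
  The measurement map of the framework, with the length of an edge replaced by its \<open>q\<close>-th power
  over \<open>q\<close>.  It carries the same information as the edge lengths, is continuously differentiable
  also where an edge degenerates, and its derivative is the rigidity matrix without any factor.
\<close>

definition edge_energy :: "real \<Rightarrow> 'v::finite set set \<Rightarrow> real ^ 'd ^ 'v \<Rightarrow> real ^ 'v set" where
  "edge_energy q E x =
     (\<chi> e. if e \<in> E then (case ends e of (v, w) \<Rightarrow> \<Sum>i\<in>UNIV. \<bar>x $ v $ i - x $ w $ i\<bar> powr q) / q else 0)"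

text \<open>
  The rigidity matrix as a linear map on placements, so that its columns need not be reindexed by
  pairs of a vertex and a coordinate.
\<close>

definition rigidity_map ::
    "real \<Rightarrow> 'v::finite set set \<Rightarrow> real ^ 'd ^ 'v \<Rightarrow> real ^ 'd ^ 'v \<Rightarrow> real ^ 'v set" where
  "rigidity_map q E x h =
     (\<chi> e. if e \<in> E then (case ends e of (v, w) \<Rightarrow> signed_power (q - 1) (x $ v - x $ w) \<bullet> (h $ v - h $ w)) else 0)"

lemma ends_cases:
  assumes "simple_graph E" "e \<in> E"
  obtains v w where "ends e = (v, w)" "e = {v, w}" "v \<noteq> w"
proof -
  obtain v w where e: "e = {v, w}" "v \<noteq> w"
    using assms by (auto simp: simple_graph_def card_2_iff)
  then have "case ends e of (v, w) \<Rightarrow> e = {v, w}"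
    unfolding ends_def by (rule_tac someI[of _ "(v, w)"]) simp
  then show ?thesis
    using that e by (cases "ends e") (force simp: doubleton_eq_iff)
qed

text \<open>
  A condition which is symmetric in the two ends of an edge does not see the ordering chosen by
  \<open>ends\<close>.
\<close>

lemma simple_graph_all_edges_iff:
  assumes "simple_graph E" "\<And>v w. R v w \<longleftrightarrow> R w v"
  shows "(\<forall>e\<in>E. case ends e of (v, w) \<Rightarrow> R v w) \<longleftrightarrow> (\<forall>v w. {v, w} \<in> E \<longrightarrow> R v w)"
proof (intro iffI allI impI ballI)
  fix v w assume *: "\<forall>e\<in>E. case ends e of (v, w) \<Rightarrow> R v w" "{v, w} \<in> E"
  then show "R v w"
    using assms(2) by (rule_tac ends_cases[OF assms(1) *(2)]) (auto simp: doubleton_eq_iff)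
next
  fix e assume *: "\<forall>v w. {v, w} \<in> E \<longrightarrow> R v w" "e \<in> E"
  then show "case ends e of (v, w) \<Rightarrow> R v w"
    by (rule_tac ends_cases[OF assms(1) *(2)]) auto
qed

lemma rigidity_map_eq_0_iff:
  fixes x h :: "real ^ 'd ^ 'v::finite"
  assumes "simple_graph E"
  shows "rigidity_map q E x h = 0 \<longleftrightarrow>
    (\<forall>v w. {v, w} \<in> E \<longrightarrow> signed_power (q - 1) (x $ v - x $ w) \<bullet> (h $ v - h $ w) = 0)"
proof -
  let ?R = "\<lambda>v w. signed_power (q - 1) (x $ v - x $ w) \<bullet> (h $ v - h $ w) = 0"
  have "?R v w \<longleftrightarrow> ?R w v" for v w
  proof -
    have "signed_power (q - 1) (x $ w - x $ v) = - signed_power (q - 1) (x $ v - x $ w)"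
      using signed_power_uminus[of "q - 1" "x $ v - x $ w"] by simp
    moreover have "h $ w - h $ v = - (h $ v - h $ w)"
      by simp
    ultimately show ?thesis
      by (simp only: inner_minus_left inner_minus_right minus_minus)
  qed
  then have "(\<forall>e\<in>E. case ends e of (v, w) \<Rightarrow> ?R v w) \<longleftrightarrow> (\<forall>v w. {v, w} \<in> E \<longrightarrow> ?R v w)"
    by (rule simple_graph_all_edges_iff[OF assms])
  moreover have "rigidity_map q E x h = 0 \<longleftrightarrow> (\<forall>e\<in>E. case ends e of (v, w) \<Rightarrow> ?R v w)"
    unfolding rigidity_map_def vec_eq_iff by (auto split: prod.splits)
  ultimately show ?thesis by (simp only:)
qed

lemma edge_energy_eq_iff:
  fixes x y :: "real ^ 'd ^ 'v::finite"
  assumes "simple_graph E" "0 < q"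
  shows "edge_energy q E x = edge_energy q E y \<longleftrightarrow>
    (\<forall>v w. {v, w} \<in> E \<longrightarrow> lq_norm q (x $ v - x $ w) = lq_norm q (y $ v - y $ w))"
proof -
  let ?R = "\<lambda>v w. lq_norm q (x $ v - x $ w) = lq_norm q (y $ v - y $ w)"
  have "lq_norm q (z $ v - z $ w) = lq_norm q (z $ w - z $ v)" for z :: "real ^ 'd ^ 'v" and v w
    using lq_norm_uminus[of q "z $ v - z $ w"] by simp
  then have "?R v w \<longleftrightarrow> ?R w v" for v w
    by metis
  then have "(\<forall>e\<in>E. case ends e of (v, w) \<Rightarrow> ?R v w) \<longleftrightarrow> (\<forall>v w. {v, w} \<in> E \<longrightarrow> ?R v w)"
    by (rule simple_graph_all_edges_iff[OF assms(1)])
  moreover have "lq_norm q a = lq_norm q b \<longleftrightarrow>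
      (\<Sum>i\<in>UNIV. \<bar>a $ i\<bar> powr q) = (\<Sum>i\<in>UNIV. \<bar>b $ i\<bar> powr q)" for a b :: "real ^ 'd"
    using lq_norm_powr[OF assms(2)] by (metis lq_norm_def)
  then have "edge_energy q E x = edge_energy q E y \<longleftrightarrow> (\<forall>e\<in>E. case ends e of (v, w) \<Rightarrow> ?R v w)"
    unfolding edge_energy_def vec_eq_iff using assms(2) by (auto split: prod.splits)
  ultimately show ?thesis by (simp only:)
qed

lemma linear_rigidity_map: "linear (rigidity_map q E x)"
proof (rule linearI)
  show "rigidity_map q E x (a + b) = rigidity_map q E x a + rigidity_map q E x b" for a b
    unfolding rigidity_map_def vec_eq_iff
    by (auto simp: inner_add_right[symmetric] add_diff_add split: prod.splits)
  show "rigidity_map q E x (c *\<^sub>R a) = c *\<^sub>R rigidity_map q E x a" for c a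
    unfolding rigidity_map_def vec_eq_iff
    by (auto simp: scaleR_diff_right[symmetric] split: prod.splits)
qed

lemma has_derivative_edge_energy:
  assumes "1 < q"
  shows "(edge_energy q E has_derivative rigidity_map q E x) (at x)"
proof -
  have "((\<lambda>x. edge_energy q E x $ e) has_derivative (\<lambda>h. rigidity_map q E x h $ e)) (at x)" for e
  proof (cases "e \<in> E")
    case True
    obtain v w where e: "ends e = (v, w)" by fastforce
    have "((\<lambda>x. \<bar>x $ v $ i - x $ w $ i\<bar> powr q) has_derivative
        (\<lambda>h. q * (sgn (x $ v $ i - x $ w $ i) * \<bar>x $ v $ i - x $ w $ i\<bar> powr (q - 1)) * (h $ v $ i - h $ w $ i))) (at x)" for i
      using has_real_derivative_abs_powr[OF assms, of "x $ v $ i - x $ w $ i", unfolded has_field_derivative_def]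
      by (rule has_derivative_compose[rotated])
         (auto intro!: bounded_linear_sub bounded_linear_imp_has_derivative
             bounded_linear_compose[OF bounded_linear_vec_nth bounded_linear_vec_nth])
    then have "((\<lambda>x. (\<Sum>i\<in>UNIV. \<bar>x $ v $ i - x $ w $ i\<bar> powr q) / q) has_derivative
        (\<lambda>h. (\<Sum>i\<in>UNIV. q * (sgn (x $ v $ i - x $ w $ i) * \<bar>x $ v $ i - x $ w $ i\<bar> powr (q - 1)) * (h $ v $ i - h $ w $ i)) / q)) (at x)"
      by (intro bounded_linear.has_derivative[OF bounded_linear_divide] has_derivative_sum)
    then show ?thesis
      using assms True e
      by (simp add: edge_energy_def rigidity_map_def inner_vec_def signed_power_def mult.assoc flip: sum_distrib_left)
  qed (simp add: edge_energy_def rigidity_map_def)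
  then show ?thesis
    by (subst has_derivative_componentwise_within) (auto simp: Basis_vec_def inner_axis)
qed

lemma continuous_on_rigidity_map:
  assumes "1 < q"
  shows "continuous_on S (\<lambda>x. rigidity_map q E x h)"
proof -
  have cont: "continuous_on S (\<lambda>x. signed_power (q - 1) (x $ v - x $ w))" for v w
    unfolding signed_power_def using assms
    by (intro continuous_on_vec_lambda continuous_on_sgn_powr continuous_intros) auto
  have "continuous_on S (\<lambda>x. rigidity_map q E x h $ e)" for e
  proof (cases "e \<in> E")
    case True
    obtain v w where "ends e = (v, w)" by fastforce
    with True cont[of v w] show ?thesis
      by (simp add: rigidity_map_def continuous_on_inner)
  qed (simp add: rigidity_map_def)
  then show ?thesis
    using continuous_on_vec_lambda[of S "\<lambda>e x. rigidity_map q E x h $ e"] by simp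
qed

lemma infinitesimal_flex_iff_rigidity_map:
  assumes "1 < q" "framework E p"
  shows "infinitesimal_flex q E p u \<longleftrightarrow> rigidity_map q E p u = 0"
proof -
  have "(\<lambda>t. lq_norm q ((p $ v + t *\<^sub>R u $ v) - (p $ w + t *\<^sub>R u $ w)) - lq_norm q (p $ v - p $ w))
      \<in> o[at 0](\<lambda>t. t) \<longleftrightarrow> signed_power (q - 1) (p $ v - p $ w) \<bullet> (u $ v - u $ w) = 0"
    if "{v, w} \<in> E" for v w
  proof -
    have ne: "p $ v - p $ w \<noteq> 0"
      using assms(2) that by (auto simp: framework_def placements_def)
    have eq: "(p $ v + t *\<^sub>R u $ v) - (p $ w + t *\<^sub>R u $ w) = (p $ v - p $ w) + t *\<^sub>R (u $ v - u $ w)" for t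
      by (simp add: algebra_simps)
    show ?thesis
      unfolding eq by (rule lq_norm_line_stationary_iff[OF assms(1) ne])
  qed
  then show ?thesis
    using assms(2) unfolding infinitesimal_flex_def framework_def
    by (auto simp: rigidity_map_eq_0_iff)
qed

text \<open>
  Flattening a placement to a vector indexed by pairs is onto, so matrix and map have the same
  range.
\<close>

lemma rank_rigidity_matrix:
  fixes x :: "real ^ 'd ^ 'v::finite"
  assumes "simple_graph E"
  shows "rank (rigidity_matrix q E x) = dim (range (rigidity_map q E x))"
proof -
  define flat :: "real ^ 'd ^ 'v \<Rightarrow> real ^ ('v \<times> 'd)" where "flat h = (\<chi> c. h $ fst c $ snd c)" for h
  have "surj flat"
  proof (rule surjI)
    show "flat (\<chi> v i. y $ (v, i)) = y" for y
      by (simp add: flat_def vec_eq_iff)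
  qed
  have "rigidity_map q E x h = rigidity_matrix q E x *v flat h" for h
  proof (rule vec_eq_iff[THEN iffD2, rule_format])
    fix e
    show "rigidity_map q E x h $ e = (rigidity_matrix q E x *v flat h) $ e"
    proof (cases "e \<in> E")
      case True
      then obtain v w where e: "ends e = (v, w)" "v \<noteq> w"
        using ends_cases[OF assms] by metis
      define g where "g = signed_power (q - 1) (x $ v - x $ w)"
      have "(rigidity_matrix q E x *v flat h) $ e =
          (\<Sum>u\<in>UNIV. \<Sum>i\<in>UNIV. rigidity_matrix q E x $ e $ (u, i) * h $ u $ i)"
        by (simp add: matrix_vector_mult_def flat_def sum.cartesian_product UNIV_Times_UNIV[symmetric]
            case_prod_unfold del: UNIV_Times_UNIV)
      also have "\<dots> = (\<Sum>u\<in>UNIV. (if u = v then g \<bullet> h $ u else 0) - (if u = w then g \<bullet> h $ u else 0))"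
        using True e by (intro sum.cong refl) (auto simp: rigidity_matrix_def inner_vec_def g_def sum_negf)
      also have "\<dots> = g \<bullet> (h $ v - h $ w)"
        by (simp add: sum_subtractf inner_diff_right)
      finally show ?thesis
        using True e by (simp add: rigidity_map_def g_def)
    qed (simp add: rigidity_map_def rigidity_matrix_def matrix_vector_mult_def split: prod.splits)
  qed
  then have "rigidity_map q E x = (\<lambda>y. rigidity_matrix q E x *v y) \<circ> flat"
    by (simp add: fun_eq_iff)
  then have "range (rigidity_map q E x) = range (\<lambda>y. rigidity_matrix q E x *v y)"
    using \<open>surj flat\<close> by (simp only: image_comp[symmetric])
  then show ?thesis
    by (simp add: rank_dim_range)
qed

section \<open>From infinitesimal to continuous flexes\<close>

text \<open>
  After \<open>w\<close> is pinned, the derivative \<open>L\<close> of the edge energies together with the position of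
  \<open>w\<close> is injective, hence bounded below, and then differentiability at the single point \<open>p\<close>
  already shows that \<open>p\<close> is isolated among the pinned placements with the same edge lengths.
  A connected path of such placements which starts at \<open>p\<close> cannot leave it.  This gives
  the conclusion on the whole time interval, not only for small times.
\<close>

lemma continuous_flex_congruent:
  fixes p :: "real ^ 'd ^ 'v::finite"
  assumes q: "1 < q" and E: "simple_graph E"
    and kernel: "\<And>u v w. rigidity_map q E p u = 0 \<Longrightarrow> u $ v = u $ w"
    and flex: "continuous_flex q E p \<alpha>" and t: "t \<in> {-1..1}"
  shows "\<alpha> v t - p $ v = \<alpha> w t - p $ w"
proof -
  define L where "L h = (rigidity_map q E p h, h $ w)" for h
  interpret A: linear "rigidity_map q E p"
    by (rule linear_rigidity_map)
  have "linear L"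
    unfolding L_def by (rule linearI) (auto simp: A.add A.scale)
  moreover have "inj L"
    unfolding linear_injective_0[OF \<open>linear L\<close>]
  proof (intro allI impI)
    fix h assume "L h = 0"
    then have "rigidity_map q E p h = 0" "h $ w = 0"
      by (auto simp: L_def zero_prod_def)
    then have "h $ v = 0" for v
      using kernel[of h v w] by simp
    then show "h = 0"
      by (simp add: vec_eq_iff)
  qed
  ultimately obtain B where B: "B > 0" "\<And>h. B * norm h \<le> norm (L h)"
    using linear_inj_bounded_below_pos by blast
  obtain \<delta> where \<delta>: "\<delta> > 0" and approx: "\<And>x. norm (x - p) < \<delta> \<Longrightarrow>
      norm (edge_energy q E x - edge_energy q E p - rigidity_map q E p (x - p)) \<le> B / 2 * norm (x - p)"
    using has_derivative_edge_energy[OF q, of E p] B(1)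
    unfolding has_derivative_at_alt by (metis half_gt_zero)
  have isolated: "x = p"
    if "norm (x - p) < \<delta>" "x $ w = p $ w" "edge_energy q E x = edge_energy q E p" for x
  proof -
    have "B * norm (x - p) \<le> B / 2 * norm (x - p)"
      using B(2)[of "x - p"] approx[OF that(1)] that by (simp add: L_def norm_Pair)
    with B(1) show ?thesis
      by (simp add: field_simps mult_le_0_iff)
  qed
  \<comment> \<open>The flex, translated back at every time so that \<open>w\<close> stays in place.\<close>
  define \<beta> where "\<beta> t = (\<chi> v. \<alpha> v t - \<alpha> w t + p $ w)" for t
  have cont: "continuous_on {-1..1} (\<lambda>t. norm (\<beta> t - p))"
    unfolding \<beta>_def using flex
    by (intro continuous_on_norm continuous_on_diff continuous_on_vec_lambda continuous_intros)
       (auto simp: continuous_flex_def)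
  have gap: "\<beta> s = p" if "s \<in> {-1..1}" "norm (\<beta> s - p) < \<delta>" for s
  proof (rule isolated[OF that(2)])
    show "\<beta> s $ w = p $ w"
      by (simp add: \<beta>_def)
    show "edge_energy q E (\<beta> s) = edge_energy q E p"
      using flex that(1) q E by (auto simp: edge_energy_eq_iff \<beta>_def continuous_flex_def)
  qed
  have "\<beta> t = p"
  proof (rule ccontr)
    assume "\<beta> t \<noteq> p"
    then have big: "\<delta> \<le> norm (\<beta> t - p)"
      using gap[OF t] by linarith
    let ?I = "(\<lambda>t. norm (\<beta> t - p)) ` {-1..1}"
    have "\<beta> 0 = p"
      using flex by (simp add: \<beta>_def vec_eq_iff continuous_flex_def)
    then have "0 \<in> ?I"
      by (intro image_eqI[of _ _ 0]) auto
    moreover have "norm (\<beta> t - p) \<in> ?I"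
      using t by blast
    moreover have "connected ?I"
      by (rule connected_continuous_image[OF cont]) simp
    ultimately have "\<delta> / 2 \<in> ?I"
      using \<delta> big by (auto intro: connectedD_interval)
    then obtain s where "s \<in> {-1..1}" "norm (\<beta> s - p) = \<delta> / 2"
      by auto
    with gap[of s] \<delta> show False by auto
  qed
  then have "\<beta> t $ v = p $ v"
    by simp
  then show ?thesis
    by (simp add: \<beta>_def algebra_simps)
qed

section \<open>Rigid motions are translations\<close>

lemma const_if_const_under_fun_upd:
  fixes F :: "('i::finite \<Rightarrow> 'a) \<Rightarrow> 'b"
  assumes "\<And>z i a. F (z(i := a)) = F z"
  shows "F z = F z'"
proof -
  have "F (\<lambda>i. if i \<in> A then z i else z' i) = F z'" if "finite A" for A
    using that
  proof induction
    case (insert j A)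
    have "(\<lambda>i. if i \<in> insert j A then z i else z' i) = (\<lambda>i. if i \<in> A then z i else z' i)(j := z j)"
      by auto
    with insert.IH show ?case
      by (simp only: assms)
  qed simp
  from this[of UNIV] show ?thesis by simp
qed

text \<open>
  Three equally spaced levels in each coordinate are what is needed to test whether the signed
  power is additive: comparing the steps \<open>0 \<rightarrow> 1\<close> and \<open>1 \<rightarrow> 2\<close> with \<open>0 \<rightarrow> 2\<close> separates \<open>q = 2\<close>,
  where rotations exist, from all other exponents.
\<close>

definition grid_level :: "3 \<Rightarrow> real" where
  "grid_level c = (if c = 1 then 0 else if c = 2 then 1 else 2)"

definition grid :: "real ^ 'd \<Rightarrow> real \<Rightarrow> ('d \<Rightarrow> 3) \<Rightarrow> real ^ 'd" where
  "grid x b z = (\<chi> i. x $ i + b * grid_level (z i))"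

text \<open>
  The complete graph on a grid is infinitesimally rigid up to translations.  Write
  \<open>\<phi> s = sgn s \<bar>s\<bar>\<^sup>q\<^sup>-\<^sup>1\<close>.  Points on a line in direction \<open>i\<close> show that \<open>\<gamma>\<^sub>i\<close> does not depend on the
  \<open>i\<close>-th coordinate.  For \<open>i \<noteq> j\<close>, pairs of points which differ in the coordinates \<open>i\<close> and \<open>j\<close>
  only then show that moving by \<open>b\<close> or \<open>2 b\<close> in direction \<open>j\<close> changes \<open>\<gamma>\<^sub>i\<close> by the same multiple
  of \<open>\<phi> b\<close> or \<open>\<phi> (2 b)\<close>.  Since \<open>\<phi> (2 b) \<noteq> 2 \<phi> b\<close> for \<open>q \<noteq> 2\<close>, this multiple is zero.
\<close>

lemma grid_kernel_translations:
  fixes \<gamma> :: "('d::finite \<Rightarrow> 3) \<Rightarrow> real ^ 'd"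
  assumes q: "1 < q" "q \<noteq> 2" and b: "b \<noteq> 0"
    and orth: "\<And>z z'. signed_power (q - 1) (grid x b z - grid x b z') \<bullet> (\<gamma> z - \<gamma> z') = 0"
  shows "\<gamma> z = \<gamma> z'"
proof -
  define \<phi> where "\<phi> s = sgn s * \<bar>s\<bar> powr (q - 1)" for s :: real
  have \<phi>0: "\<phi> 0 = 0" and \<phi>neg: "\<phi> (- s) = - \<phi> s" and \<phi>nz: "\<phi> s = 0 \<longleftrightarrow> s = 0" for s
    by (auto simp: \<phi>_def sgn_minus sgn_0_0)
  have "(2::real) powr (q - 1) \<noteq> 2 powr 1"
    using q by (subst powr_inj) auto
  moreover have "\<phi> (2 * b) = 2 powr (q - 1) * \<phi> b"
    by (simp add: \<phi>_def sgn_mult abs_mult powr_mult)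
  ultimately have nonadditive: "\<phi> (2 * b) \<noteq> 2 * \<phi> b"
    using b by (simp add: \<phi>nz)
  have orth': "(\<Sum>i\<in>UNIV. \<phi> (b * (grid_level (z i) - grid_level (z' i))) * (\<gamma> z $ i - \<gamma> z' $ i)) = 0" for z z'
    using orth[of z z'] by (simp add: inner_vec_def signed_power_def grid_def \<phi>_def right_diff_distrib)
  have level_eq: "grid_level c = grid_level c' \<longleftrightarrow> c = c'" for c c'
    using exhaust_3[of c] exhaust_3[of c'] by (auto simp: grid_level_def)
  have own: "\<gamma> (z(i := c)) $ i = \<gamma> z $ i" for z i c
  proof (cases "c = z i")
    case False
    have "(\<Sum>j\<in>UNIV. \<phi> (b * (grid_level ((z(i := c)) j) - grid_level (z j))) * (\<gamma> (z(i := c)) $ j - \<gamma> z $ j)) =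
        (\<Sum>j\<in>UNIV. if j = i then \<phi> (b * (grid_level c - grid_level (z i))) * (\<gamma> (z(i := c)) $ i - \<gamma> z $ i) else 0)"
      by (intro sum.cong refl) (auto simp: \<phi>0)
    then have "\<phi> (b * (grid_level c - grid_level (z i))) * (\<gamma> (z(i := c)) $ i - \<gamma> z $ i) = 0"
      using orth'[of "z(i := c)" z] by simp
    with b False show ?thesis
      by (simp add: \<phi>nz level_eq)
  qed simp
  have other: "\<gamma> (z(j := c)) $ i = \<gamma> z $ i" if "i \<noteq> j" for z i j c
  proof -
    define g where "g c = \<gamma> (z(j := c)) $ i" for c
    \<comment> \<open>By \<open>own\<close>, this difference is the same for every level of the \<open>j\<close>-th coordinate.\<close>
    define D where "D = \<gamma> (z(i := 2)) $ j - \<gamma> (z(i := 1)) $ j"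
    have square: "\<phi> b * (g c - g c') + \<phi> (b * (grid_level c - grid_level c')) * D = 0" for c c'
    proof -
      let ?z = "z(i := 2, j := c)" and ?z' = "z(i := 1, j := c')"
      have vals: "\<gamma> ?z $ j = \<gamma> (z(i := 2)) $ j" "\<gamma> ?z' $ j = \<gamma> (z(i := 1)) $ j"
          "\<gamma> ?z $ i = g c" "\<gamma> ?z' $ i = g c'"
        using own[of "z(i := 2)" j c] own[of "z(i := 1)" j c'] own[of "z(j := c)" i 2] own[of "z(j := c')" i 1] that
        by (auto simp: g_def fun_upd_twist)
      have "(\<Sum>k\<in>UNIV. \<phi> (b * (grid_level (?z k) - grid_level (?z' k))) * (\<gamma> ?z $ k - \<gamma> ?z' $ k)) =
          (\<Sum>k\<in>UNIV. (if k = i then \<phi> b * (g c - g c') else 0) +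
             (if k = j then \<phi> (b * (grid_level c - grid_level c')) * D else 0))"
        using that vals by (intro sum.cong refl) (auto simp: \<phi>0 grid_level_def D_def)
      then show ?thesis
        using orth'[of ?z ?z'] by (simp add: sum.distrib)
    qed
    have s1: "\<phi> b * (g 2 - g 1) + \<phi> b * D = 0" and s2: "\<phi> b * (g 3 - g 2) + \<phi> b * D = 0"
      and s3: "\<phi> b * (g 3 - g 1) + \<phi> (2 * b) * D = 0"
      using square[of 2 1] square[of 3 2] square[of 3 1] by (simp_all add: grid_level_def mult.commute)
    have "(\<phi> (2 * b) - 2 * \<phi> b) * D = (\<phi> b * (g 3 - g 1) + \<phi> (2 * b) * D)
        - (\<phi> b * (g 2 - g 1) + \<phi> b * D) - (\<phi> b * (g 3 - g 2) + \<phi> b * D)"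
      by (simp add: algebra_simps)
    also have "\<dots> = 0"
      by (simp only: s1 s2 s3)
    finally have "(\<phi> (2 * b) - 2 * \<phi> b) * D = 0" .
    with nonadditive have "D = 0" by simp
    with s1 s2 b have "g 2 = g 1" "g 3 = g 2"
      by (simp_all add: \<phi>nz)
    then have "g c = g (z j)"
      using exhaust_3[of c] exhaust_3[of "z j"] by auto
    then show ?thesis by (simp add: g_def)
  qed
  have "\<gamma> (z(j := c)) = \<gamma> z" for z j c
    unfolding vec_eq_iff
  proof
    show "\<gamma> (z(j := c)) $ i = \<gamma> z $ i" for i
      using own[of z i c] other[of i j z c] by (cases "i = j") auto
  qed
  then show ?thesis
    by (rule const_if_const_under_fun_upd)
qed

text \<open>
  A rigid motion moves the points of a grid by a continuous flex of the complete graph, and grids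
  are infinitesimally rigid, so the motion translates each grid.  Two points which differ in one
  coordinate lie in a common grid, and any two points are joined by changing one coordinate at a
  time.
\<close>

lemma rigid_motion_translation:
  fixes x y :: "real ^ 'd"
  assumes q: "1 < q" "q \<noteq> 2" and \<Gamma>: "rigid_motion q \<Gamma>" and t: "t \<in> {-1..1}"
  shows "\<Gamma> x t - x = \<Gamma> y t - y"
proof -
  define E :: "('d \<Rightarrow> 3) set set" where "E = {e. card e = 2}"
  have E: "simple_graph E" "{v, w} \<in> E \<longleftrightarrow> v \<noteq> w" for v w
    by (auto simp: E_def simple_graph_def card_2_iff doubleton_eq_iff)
  have step: "\<Gamma> (x + b *\<^sub>R axis j 1) t - (x + b *\<^sub>R axis j 1) = \<Gamma> x t - x" for x :: "real ^ 'd" and b j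
  proof (cases "b = 0")
    case False
    define p :: "real ^ 'd ^ ('d \<Rightarrow> 3)" where "p = (\<chi> z. grid x b z)"
    have "continuous_flex q E p (\<lambda>z. \<Gamma> (grid x b z))"
      using \<Gamma> by (simp add: continuous_flex_def rigid_motion_def p_def)
    moreover have "u $ v = u $ w" if "rigidity_map q E p u = 0" for u v w
    proof (rule grid_kernel_translations[OF q False, of x "\<lambda>z. u $ z"])
      fix z z'
      show "signed_power (q - 1) (grid x b z - grid x b z') \<bullet> (u $ z - u $ z') = 0"
        using that E(2)[of z z'] unfolding rigidity_map_eq_0_iff[OF E(1)] p_def
        by (cases "z = z'") auto
    qed
    ultimately have "\<Gamma> (grid x b z) t - grid x b z = \<Gamma> (grid x b z') t - grid x b z'" for z z'
      using continuous_flex_congruent[OF q(1) E(1) _ _ t, of p "\<lambda>z. \<Gamma> (grid x b z)" z z']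
      by (simp add: p_def)
    moreover have "grid x b (\<lambda>_. 1) = x" "grid x b ((\<lambda>_. 1)(j := 2)) = x + b *\<^sub>R axis j 1"
      by (auto simp: grid_def grid_level_def vec_eq_iff axis_def)
    ultimately show ?thesis by metis
  qed simp
  define F where "F h = \<Gamma> (vec_lambda h) t - vec_lambda h" for h
  have "F (h(j := a)) = F h" for h j a
  proof -
    have "vec_lambda (h(j := a)) = vec_lambda h + (a - h j) *\<^sub>R axis j 1"
      by (simp add: vec_eq_iff axis_def)
    then show ?thesis
      using step[of "vec_lambda h" "a - h j" j] by (simp add: F_def)
  qed
  then have "F (vec_nth x) = F (vec_nth y)"
    by (rule const_if_const_under_fun_upd)
  then show ?thesis by (simp add: F_def)
qed

section \<open>Trivial flexes\<close>

lemma translation_rigid_motion: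
  assumes "continuous_on {-1..1} c" "c 0 = 0"
  shows "rigid_motion q (\<lambda>x t. x + c t)"
  using assms by (auto simp: rigid_motion_def intro!: continuous_intros)

lemma trivial_continuous_flex_iff:
  fixes p :: "real ^ 'd ^ 'v"
  assumes "1 < q" "q \<noteq> 2" "continuous_flex q E p \<alpha>"
  shows "trivial_continuous_flex q p \<alpha> \<longleftrightarrow> (\<forall>t\<in>{-1..1}. \<forall>v w. \<alpha> v t - p $ v = \<alpha> w t - p $ w)"
proof
  assume "trivial_continuous_flex q p \<alpha>"
  then obtain \<Gamma> where "rigid_motion q \<Gamma>" "\<And>v t. t \<in> {-1..1} \<Longrightarrow> \<alpha> v t = \<Gamma> (p $ v) t"
    unfolding trivial_continuous_flex_def by blast
  then show "\<forall>t\<in>{-1..1}. \<forall>v w. \<alpha> v t - p $ v = \<alpha> w t - p $ w"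
    using rigid_motion_translation[OF assms(1,2)] by metis
next
  fix v0 :: 'v
  assume *: "\<forall>t\<in>{-1..1}. \<forall>v w. \<alpha> v t - p $ v = \<alpha> w t - p $ w"
  have "rigid_motion q (\<lambda>x t. x + (\<alpha> v0 t - p $ v0))"
    using assms(3) by (intro translation_rigid_motion continuous_intros) (auto simp: continuous_flex_def)
  moreover have "\<alpha> v t = p $ v + (\<alpha> v0 t - p $ v0)" if "t \<in> {-1..1}" for v t
    using *[rule_format, OF that, of v v0] by (simp add: algebra_simps)
  ultimately show "trivial_continuous_flex q p \<alpha>"
    unfolding trivial_continuous_flex_def by blast
qed

text \<open>
  If the motion translates, its velocity field is constant; conversely a constant field belongs
  to a translation with constant velocity.
\<close>

lemma trivial_infinitesimal_flex_iff:
  fixes p u :: "real ^ 'd ^ 'v"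
  assumes "1 < q" "q \<noteq> 2"
  shows "trivial_infinitesimal_flex q p u \<longleftrightarrow> (\<forall>v w. u $ v = u $ w)"
proof
  assume "trivial_infinitesimal_flex q p u"
  then obtain \<gamma> \<Gamma> where \<Gamma>: "rigid_motion q \<Gamma>"
      and d: "\<And>x. (\<Gamma> x has_vector_derivative \<gamma> x) (at 0 within {-1..1})" and u: "\<And>v. u $ v = \<gamma> (p $ v)"
    unfolding trivial_infinitesimal_flex_def infinitesimal_rigid_motion_def by metis
  have "\<gamma> x = \<gamma> y" for x y
  proof -
    have "((\<lambda>t. \<Gamma> y t + (x - y)) has_vector_derivative \<gamma> y) (at 0 within {-1..1})"
      using d[of y] by (auto intro!: derivative_eq_intros)
    moreover have "\<Gamma> x t = \<Gamma> y t + (x - y)" if "t \<in> {-1..1}" for t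
      using rigid_motion_translation[OF assms \<Gamma> that, of x y] by (simp add: algebra_simps)
    ultimately have "(\<Gamma> x has_vector_derivative \<gamma> y) (at 0 within {-1..1})"
      using has_vector_derivative_transform[of 0 "{-1..1}" "\<Gamma> x" "\<lambda>t. \<Gamma> y t + (x - y)" "\<gamma> y"] by simp
    then show ?thesis
      using vector_derivative_unique_within_closed_interval[of "-1" 1 0] d[of x] by auto
  qed
  with u show "\<forall>v w. u $ v = u $ w" by metis
next
  fix v0 :: 'v
  assume *: "\<forall>v w. u $ v = u $ w"
  have "rigid_motion q (\<lambda>x t. x + t *\<^sub>R u $ v0)"
    by (intro translation_rigid_motion continuous_intros) auto
  moreover have "((\<lambda>t. x + t *\<^sub>R u $ v0) has_vector_derivative u $ v0) (at 0 within {-1..1})" for x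
    by (auto intro!: derivative_eq_intros)
  ultimately have "infinitesimal_rigid_motion q (\<lambda>_. u $ v0)"
    unfolding infinitesimal_rigid_motion_def by blast
  with * show "trivial_infinitesimal_flex q p u"
    unfolding trivial_infinitesimal_flex_def by metis
qed

lemma infinitesimally_rigid_iff_kernel:
  fixes p :: "real ^ 'd ^ 'v::finite"
  assumes "1 < q" "q \<noteq> 2" "framework E p"
  shows "infinitesimally_rigid q E p \<longleftrightarrow> (\<forall>u. rigidity_map q E p u = 0 \<longrightarrow> (\<forall>v w. u $ v = u $ w))"
  using assms unfolding infinitesimally_rigid_def
  by (simp add: infinitesimal_flex_iff_rigidity_map trivial_infinitesimal_flex_iff)

section \<open>Regular placements\<close>

text \<open>
  Translations lie in the kernel of the rigidity map at every placement, so a kernel which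
  consists of translations has the least possible dimension.
\<close>

lemma translation_kernel_imp_regular:
  fixes p :: "real ^ 'd ^ 'v::finite"
  assumes E: "simple_graph E"
    and kernel: "\<And>u v w. rigidity_map q E p u = 0 \<Longrightarrow> u $ v = u $ w"
  shows "regular q E p"
proof -
  have "dim (range (rigidity_map q E x)) \<le> dim (range (rigidity_map q E p))" for x :: "real ^ 'd ^ 'v"
  proof -
    have "rigidity_map q E x u = 0" if "rigidity_map q E p u = 0" for u
    proof -
      have "u $ v - u $ w = 0" for v w
        using kernel[OF that, of v w] by simp
      then show ?thesis
        unfolding rigidity_map_eq_0_iff[OF E] by (simp only: inner_zero_right simp_thms)
    qed
    then have "dim {u. rigidity_map q E p u = 0} \<le> dim {u. rigidity_map q E x u = 0}"
      by (intro dim_subset) auto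
    then show ?thesis
      using dim_kernel_plus_dim_range[OF linear_rigidity_map, of q E x]
        dim_kernel_plus_dim_range[OF linear_rigidity_map, of q E p] by simp
  qed
  then show ?thesis
    by (simp add: regular_def rank_rigidity_matrix[OF E])
qed

lemma open_placements: "open (placements E :: (real ^ 'd ^ 'v::finite) set)"
proof -
  have "placements E = (\<Inter>v. \<Inter>w. {p :: real ^ 'd ^ 'v. {v, w} \<in> E \<longrightarrow> p $ v \<noteq> p $ w})"
    by (auto simp: placements_def)
  moreover have "open {p :: real ^ 'd ^ 'v. {v, w} \<in> E \<longrightarrow> p $ v \<noteq> p $ w}" for v w
    by (cases "{v, w} \<in> E") (auto intro!: open_Collect_neq continuous_intros)
  ultimately show ?thesis
    by (auto intro!: open_INT)
qed

text \<open>
  The placements form an open set, on which the rank of the derivative of the edge energies is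
  largest at a regular point; so the constant rank theorem turns \<open>u\<close> into a path.  The path exists
  for a short time only, and slowing it down by a factor \<open>\<epsilon>\<close> stretches it to the interval
  \<open>{-1..1}\<close>.
\<close>

lemma regular_infinitesimal_flex_integrates:
  fixes p u :: "real ^ 'd ^ 'v::finite"
  assumes q: "1 < q" and p: "framework E p" and reg: "regular q E p" and u: "rigidity_map q E p u = 0"
  obtains \<alpha> \<epsilon> where "\<epsilon> > 0" "continuous_flex q E p \<alpha>"
    "\<And>v. (\<alpha> v has_vector_derivative \<epsilon> *\<^sub>R u $ v) (at 0)"
proof -
  have E: "simple_graph E" and pE: "p \<in> placements E"
    using p by (auto simp: framework_def)
  define f' where "f' x = Blinfun (rigidity_map q E x)" for x :: "real ^ 'd ^ 'v"
  have f': "blinfun_apply (f' x) = rigidity_map q E x" for x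
    unfolding f'_def
    by (rule bounded_linear_Blinfun_apply) (simp add: linear_rigidity_map flip: linear_conv_bounded_linear)
  have "continuous_on (placements E) f'"
    by (intro continuous_on_blinfun_componentwise) (simp add: f' continuous_on_rigidity_map[OF q])
  moreover have "dim (range (f' x)) \<le> dim (range (f' p))" if "x \<in> placements E" for x
    using reg that by (simp add: regular_def rank_rigidity_matrix[OF E] f')
  moreover have "(edge_energy q E has_derivative f' x) (at x)" for x
    by (simp add: f' has_derivative_edge_energy[OF q])
  ultimately obtain \<beta> \<epsilon> where \<epsilon>: "\<epsilon> > 0" and \<beta>: "\<beta> 0 = p" "continuous_on {-\<epsilon>..\<epsilon>} \<beta>"
      "\<And>t. t \<in> {-\<epsilon>..\<epsilon>} \<Longrightarrow> edge_energy q E (\<beta> t) = edge_energy q E p" "(\<beta> has_vector_derivative u) (at 0)"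
    using curve_in_level_set_of_maximal_rank[OF open_placements pE, of "edge_energy q E" f' u] u f' by metis
  define \<alpha> where "\<alpha> v t = \<beta> (\<epsilon> * t) $ v" for v t
  have rescale: "\<epsilon> * t \<in> {-\<epsilon>..\<epsilon>}" if "t \<in> {-1..1}" for t
    using that \<epsilon> mult_left_mono[of t 1 \<epsilon>] mult_left_mono[of "-1" t \<epsilon>] by auto
  have "continuous_flex q E p \<alpha>"
    unfolding continuous_flex_def
  proof (intro conjI allI ballI impI)
    show "continuous_on {-1..1} (\<alpha> v)" for v
      unfolding \<alpha>_def using rescale
      by (intro continuous_on_component continuous_on_compose2[OF \<beta>(2)] continuous_intros) auto
    show "\<alpha> v 0 = p $ v" for v
      by (simp add: \<alpha>_def \<beta>(1))
    show "lq_norm q (\<alpha> v t - \<alpha> w t) = lq_norm q (p $ v - p $ w)" if "t \<in> {-1..1}" "{v, w} \<in> E" for t v w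
      using \<beta>(3)[OF rescale[OF that(1)]] that(2) q E by (simp add: edge_energy_eq_iff \<alpha>_def)
  qed
  moreover have "(\<alpha> v has_vector_derivative \<epsilon> *\<^sub>R u $ v) (at 0)" for v
  proof -
    have "((\<lambda>t. \<epsilon> * t) has_vector_derivative \<epsilon>) (at 0)"
      by (auto intro!: derivative_eq_intros)
    then have "(\<beta> \<circ> (\<lambda>t. \<epsilon> * t) has_vector_derivative \<epsilon> *\<^sub>R u) (at 0)"
      using \<beta>(4) by (intro vector_diff_chain_at) simp_all
    then have "((\<lambda>t. \<beta> (\<epsilon> * t) $ v) has_vector_derivative (\<epsilon> *\<^sub>R u) $ v) (at 0)"
      unfolding o_def by (rule bounded_linear.has_vector_derivative[OF bounded_linear_vec_nth])
    then show ?thesis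
      by (simp add: \<alpha>_def[abs_def])
  qed
  ultimately show ?thesis
    using that \<epsilon> by blast
qed

section \<open>Continuous and infinitesimal rigidity\<close>

theorem theorem6p3:
  fixes E :: "'v::finite set set"
    and p :: "real ^ 'd ^ 'v"
    and q :: real
  assumes "CARD('d) \<ge> 2"
    and "q \<in> {1<..<2} \<union> {2<..}"
    and "framework E p"
    and "p \<notin> coincidence_variety E"
  shows "continuously_rigid q E p \<and> regular q E p \<longleftrightarrow> infinitesimally_rigid q E p"
proof -
  have q: "1 < q" "q \<noteq> 2"
    using assms(2) by auto
  have E: "simple_graph E"
    using assms(3) by (simp add: framework_def)
  show ?thesis
    unfolding infinitesimally_rigid_iff_kernel[OF q assms(3)]
  proof (intro iffI allI impI)
    fix u v w
    assume "continuously_rigid q E p \<and> regular q E p" and u: "rigidity_map q E p u = 0"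
    \<comment> \<open>The flex with initial velocity \<open>\<epsilon> u\<close> is a translation at every time, so its velocities at any
      two vertices agree.\<close>
    then obtain \<alpha> \<epsilon> where "\<epsilon> > 0" and flex: "continuous_flex q E p \<alpha>"
        and d: "\<And>v. (\<alpha> v has_vector_derivative \<epsilon> *\<^sub>R u $ v) (at 0)" and "trivial_continuous_flex q p \<alpha>"
      using regular_infinitesimal_flex_integrates[OF q(1) assms(3) _ u] unfolding continuously_rigid_def by metis
    then have eq: "\<alpha> v t = \<alpha> w t + (p $ v - p $ w)" if "t \<in> {-1<..<1}" for t
      using that trivial_continuous_flex_iff[OF q flex] by (force simp: algebra_simps)
    have "((\<lambda>t. \<alpha> w t + (p $ v - p $ w)) has_vector_derivative \<epsilon> *\<^sub>R u $ w) (at 0)"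
      using d[of w] by (auto intro!: derivative_eq_intros)
    then have "(\<alpha> v has_vector_derivative \<epsilon> *\<^sub>R u $ w) (at 0)"
      by (rule has_vector_derivative_transform_within_open[where S = "{-1<..<1}"]) (auto simp: eq)
    then have "\<epsilon> *\<^sub>R u $ w = \<epsilon> *\<^sub>R u $ v"
      using vector_derivative_unique_at d by blast
    with \<open>\<epsilon> > 0\<close> show "u $ v = u $ w" by simp
  next
    assume "\<forall>u. rigidity_map q E p u = 0 \<longrightarrow> (\<forall>v w. u $ v = u $ w)"
    then have kernel: "u $ v = u $ w" if "rigidity_map q E p u = 0" for u v w
      using that by blast
    have "continuously_rigid q E p"
      unfolding continuously_rigid_def
      using trivial_continuous_flex_iff[OF q] continuous_flex_congruent[OF q(1) E kernel] by blast
    with translation_kernel_imp_regular[OF E kernel]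
    show "continuously_rigid q E p \<and> regular q E p" by blast
  qed
qed

end
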